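(* Let $\mathcal{A}$ be a unitary commutative algebra over a field $\mathbb{K}$ of characteristic zero and let $q$ be a Poisson bracket on $\mathcal{A}$. Let $\mathrm{a}_i,\mathrm{b}_i\in\mathcal{A}$, $i=1,\dots,n$, be elements such that $$q(\mathrm{a}_i,\mathrm{a}_j)=q(\mathrm{b}_i,\mathrm{b}_j)=0\ \text{ for all } i,j,\qquad q(\mathrm{a}_i,\mathrm{b}_j)=0\ \text{ for } i\neq j,\qquad q(\mathrm{a}_i,\mathrm{b}_i)=1\ \text{ for } i=1,\dots,n,$$ and such that the $\mathrm{a}_i,\mathrm{b}_i$ generate a dense subalgebra of $\mathcal{A}$. Put $\mathrm{A}_k=q(\cdot,\mathrm{b}_k)$, $\mathrm{B}_k=q(\mathrm{a}_k,\cdot)$, $k=1,\dots,n$. Then the Grönewold–Moyal product $$(f\ast g)(t)=fg+\sum_{k=1}^{\infty}\frac{t^k}{k!}\mathrm{Q}_k(f,g),\qquad f,g\in\mathcal{A},$$ is a deformation quantization of the bracket $q$, where $\mathrm{Q}_1=q$ and for $k=2,3,\dots$ $$\mathrm{Q}_k(f,g)=\sum_{j=0}^{k}(-1)^{k-j}\frac{k!}{j!(k-j)!}\sum_{i_1,\dots,i_k=1}^{n}\mathrm{A}_{i_1}\cdots\mathrm{A}_{i_j}\mathrm{B}_{i_{j+1}}\cdots\mathrm{B}_{i_k}(f)\;\mathrm{B}_{i_1}\cdots\mathrm{B}_{i_j}\mathrm{A}_{i_{j+1}}\cdots\mathrm{A}_{i_k}(g).$$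
   Context: A Poisson bracket on $\mathcal{A}$ is a skew-symmetric $\mathbb{K}$-bilinear map $\mathcal{A}\times\mathcal{A}\to\mathcal{A}$ that is a derivation in each argument and satisfies the Jacobi identity. A subalgebra $\mathcal{B}$ of $\mathcal{A}$ is called dense if any derivation $\delta:\mathcal{A}\to\mathcal{A}$ with $\delta|_{\mathcal{B}}=0$ vanishes on $\mathcal{A}$. A deformation quantization of $q$ is a formal power series product $f\ast g=fg+\sum_{k\ge1}\frac{t^k}{k!}\mathrm{Q}_k(f,g)$ with $\mathbb{K}$-bilinear $\mathrm{Q}_k:\mathcal{A}\times\mathcal{A}\to\mathcal{A}$ and $\mathrm{Q}_1=q$, whose $\mathbb{K}[[t]]$-bilinear extension to $\mathcal{A}[[t]]$ is associative. *)

theory Defs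
  imports "HOL-Computational_Algebra.Formal_Power_Series"
begin

text \<open>
  The unit \<^term>\<open>e\<close> is a parameter, and the underlying class is \<^class>\<open>comm_ring\<close>, because
  \<^class>\<open>comm_ring_1\<close> would exclude the zero algebra.
\<close>

locale unital_comm_algebra = vector_space scale
  for scale :: "'k::field \<Rightarrow> 'a::comm_ring \<Rightarrow> 'a" +
  fixes e :: 'a
  assumes unit_mult: "e * x = x"
    and scale_mult: "scale c (x * y) = scale c x * y"

definition subalgebra :: "('k::field \<Rightarrow> 'a::comm_ring \<Rightarrow> 'a) \<Rightarrow> 'a \<Rightarrow> 'a set \<Rightarrow> bool" where
  "subalgebra scale e B \<longleftrightarrow>
     module.subspace scale B \<and> e \<in> B \<and> (\<forall>x\<in>B. \<forall>y\<in>B. x * y \<in> B)"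

definition derivation :: "('k::field \<Rightarrow> 'a::comm_ring \<Rightarrow> 'a) \<Rightarrow> ('a \<Rightarrow> 'a) \<Rightarrow> bool" where
  "derivation scale \<delta> \<longleftrightarrow>
     Vector_Spaces.linear scale scale \<delta> \<and> (\<forall>x y. \<delta> (x * y) = \<delta> x * y + x * \<delta> y)"

definition dense_subalgebra :: "('k::field \<Rightarrow> 'a::comm_ring \<Rightarrow> 'a) \<Rightarrow> 'a \<Rightarrow> 'a set \<Rightarrow> bool" where
  "dense_subalgebra scale e B \<longleftrightarrow> subalgebra scale e B \<and>
     (\<forall>\<delta>. derivation scale \<delta> \<longrightarrow> (\<forall>x\<in>B. \<delta> x = 0) \<longrightarrow> (\<forall>x. \<delta> x = 0))"

definition module_bilinear ::
  "('r::comm_ring_1 \<Rightarrow> 'm::ab_group_add \<Rightarrow> 'm) \<Rightarrow> ('m \<Rightarrow> 'm \<Rightarrow> 'm) \<Rightarrow> bool" where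
  "module_bilinear s M \<longleftrightarrow>
     (\<forall>x. module_hom s s (\<lambda>y. M x y)) \<and> (\<forall>y. module_hom s s (\<lambda>x. M x y))"

definition poisson_bracket ::
  "('k::field \<Rightarrow> 'a::comm_ring \<Rightarrow> 'a) \<Rightarrow> ('a \<Rightarrow> 'a \<Rightarrow> 'a) \<Rightarrow> bool" where
  "poisson_bracket scale q \<longleftrightarrow>
     module_bilinear scale q \<and>
     (\<forall>f g. q f g = - q g f) \<and>
     (\<forall>f. derivation scale (\<lambda>g. q f g)) \<and> (\<forall>g. derivation scale (\<lambda>f. q f g)) \<and>
     (\<forall>f g h. q f (q g h) + q g (q h f) + q h (q f g) = 0)"

text \<open>The action of \<open>K[[t]]\<close> on \<open>A[[t]]\<close>.\<close>

definition fps_scale :: "('k::field \<Rightarrow> 'a::comm_ring \<Rightarrow> 'a) \<Rightarrow> 'k fps \<Rightarrow> 'a fps \<Rightarrow> 'a fps" where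
  "fps_scale scale c F = Abs_fps (\<lambda>m. \<Sum>i=0..m. scale (fps_nth c i) (fps_nth F (m - i)))"

text \<open>The value \<^term>\<open>Q 0\<close> is not used: the coefficient of \<open>t\<^sup>0\<close> is the product of the algebra.\<close>

definition star ::
  "('k::field_char_0 \<Rightarrow> 'a::comm_ring \<Rightarrow> 'a) \<Rightarrow> (nat \<Rightarrow> 'a \<Rightarrow> 'a \<Rightarrow> 'a) \<Rightarrow> 'a \<Rightarrow> 'a \<Rightarrow> 'a fps" where
  "star scale Q f g = Abs_fps (\<lambda>k. if k = 0 then f * g else scale (1 / fact k) (Q k f g))"

definition bilinear_extension ::
  "('k::field \<Rightarrow> 'a::comm_ring \<Rightarrow> 'a) \<Rightarrow> ('a \<Rightarrow> 'a \<Rightarrow> 'a fps) \<Rightarrow>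
   ('a fps \<Rightarrow> 'a fps \<Rightarrow> 'a fps) \<Rightarrow> bool" where
  "bilinear_extension scale p M \<longleftrightarrow>
     module_bilinear (fps_scale scale) M \<and> (\<forall>f g. M (fps_const f) (fps_const g) = p f g)"

lemma fps_scale_nth:
  "fps_nth (fps_scale scale c F) m = (\<Sum>i=0..m. scale (fps_nth c i) (fps_nth F (m - i)))"
  by (simp add: fps_scale_def)

lemma fps_scale_X_power_nth:
  assumes "vector_space scale"
  shows "fps_nth (fps_scale scale (fps_X ^ N) F) m = (if m < N then 0 else fps_nth F (m - N))"
proof -
  interpret vector_space scale by (rule assms)
  have "fps_nth (fps_scale scale (fps_X ^ N) F) m
      = (\<Sum>i=0..m. if i = N then fps_nth F (m - i) else 0)"
    unfolding fps_scale_nth by (rule sum.cong) (auto simp: fps_X_power_iff)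
  then show ?thesis by auto
qed

lemma module_fps_scale:
  assumes "vector_space scale"
  shows "module (fps_scale scale)"
proof -
  interpret vector_space scale by (rule assms)
  show ?thesis
  proof
    fix c d :: "'a fps" and F G :: "'b fps"
    show "fps_scale scale c (F + G) = fps_scale scale c F + fps_scale scale c G"
      by (simp add: fps_eq_iff fps_scale_nth scale_right_distrib sum.distrib)
    show "fps_scale scale (c + d) F = fps_scale scale c F + fps_scale scale d F"
      by (simp add: fps_eq_iff fps_scale_nth scale_left_distrib sum.distrib)
    show "fps_scale scale 1 F = F"
      using fps_scale_X_power_nth[OF assms, of 0 F] by (simp add: fps_eq_iff)
    show "fps_scale scale c (fps_scale scale d F) = fps_scale scale (c * d) F"
    proof (rule fps_ext)
      fix m
      let ?h = "\<lambda>i j. scale (fps_nth c i * fps_nth d j) (fps_nth F (m - (i + j)))"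
      have "fps_nth (fps_scale scale c (fps_scale scale d F)) m
          = (\<Sum>i=0..m. \<Sum>j=0..m-i. ?h i j)"
        by (simp add: fps_scale_nth scale_sum_right diff_diff_add)
      also have "\<dots> = (\<Sum>k=0..m. \<Sum>i=0..k. ?h i (k - i))"
        using sum.triangle_reindex_eq[of "\<lambda>i j. ?h i j" m]
        by (simp add: sum.Sigma[symmetric] atLeast0AtMost pairs_le_eq_Sigma)
      also have "\<dots> = fps_nth (fps_scale scale (c * d) F) m"
        by (simp add: fps_scale_nth fps_mult_nth scale_sum_left)
      finally show "fps_nth (fps_scale scale c (fps_scale scale d F)) m
          = fps_nth (fps_scale scale (c * d) F) m" .
    qed
  qed
qed

text \<open>
  A \<open>K[[t]]\<close>-linear map on \<open>A[[t]]\<close> sends \<open>t\<^sup>N A[[t]]\<close> into \<open>t\<^sup>N A[[t]]\<close>, so it is determined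
  by its values on constant series even if \<open>A\<close> is infinite-dimensional.
\<close>

lemma fps_linear_unique:
  assumes vs: "vector_space scale"
    and L: "module_hom (fps_scale scale) (fps_scale scale) L"
    and L': "module_hom (fps_scale scale) (fps_scale scale) L'"
    and eq: "\<And>f. L (fps_const f) = L' (fps_const f)"
  shows "L F = L' F"
proof (rule fps_ext)
  fix m
  interpret vector_space scale by (rule vs)
  interpret L: module_hom "fps_scale scale" "fps_scale scale" L by (rule L)
  interpret L': module_hom "fps_scale scale" "fps_scale scale" L' by (rule L')
  show "fps_nth (L F) m = fps_nth (L' F) m"
  proof (induction m arbitrary: F)
    case 0
    have d: "F = fps_const (fps_nth F 0) + fps_scale scale fps_X (fps_shift 1 F)"
      using fps_scale_X_power_nth[OF vs, of 1 "fps_shift 1 F"] by (auto simp: fps_eq_iff)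
    show ?case
      using fps_scale_X_power_nth[OF vs, of 1]
      by (subst (1 2) d) (simp add: L.add L'.add L.scale L'.scale eq)
  next
    case (Suc m)
    have d: "F = fps_const (fps_nth F 0) + fps_scale scale fps_X (fps_shift 1 F)"
      using fps_scale_X_power_nth[OF vs, of 1 "fps_shift 1 F"] by (auto simp: fps_eq_iff)
    show ?case
      using fps_scale_X_power_nth[OF vs, of 1] Suc.IH[of "fps_shift 1 F"]
      by (subst (1 2) d) (simp add: L.add L'.add L.scale L'.scale eq)
  qed
qed

lemma bilinear_extension_unique:
  assumes vs: "vector_space scale"
    and M: "bilinear_extension scale p M" and M': "bilinear_extension scale p M'"
  shows "M = M'"
proof (intro ext)
  fix F G
  have c: "M (fps_const f) G = M' (fps_const f) G" for f
    by (rule fps_linear_unique[OF vs, where F = G])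
       (use M M' in \<open>auto simp: bilinear_extension_def module_bilinear_def\<close>)
  show "M F G = M' F G"
    by (rule fps_linear_unique[OF vs, where F = F])
       (use M M' c in \<open>auto simp: bilinear_extension_def module_bilinear_def\<close>)
qed

text \<open>
  By the uniqueness lemma just proved, the \<open>M\<close> below is \<^emph>\<open>the\<close> \<open>K[[t]]\<close>-bilinear extension.
\<close>

definition deformation_quantization ::
  "('k::field_char_0 \<Rightarrow> 'a::comm_ring \<Rightarrow> 'a) \<Rightarrow> ('a \<Rightarrow> 'a \<Rightarrow> 'a) \<Rightarrow>
   (nat \<Rightarrow> 'a \<Rightarrow> 'a \<Rightarrow> 'a) \<Rightarrow> bool" where
  "deformation_quantization scale q Q \<longleftrightarrow>
     (\<forall>k\<ge>1. module_bilinear scale (Q k)) \<and> Q 1 = q \<and>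
     (\<exists>M. bilinear_extension scale (star scale Q) M \<and>
          (\<forall>F G H. M (M F G) H = M F (M G H)))"

text \<open>
  A multi-index \<open>(i\<^sub>1, \<dots>, i\<^sub>k)\<close> is a list \<open>is\<close> of length \<open>k\<close>, and
  \<open>foldr A [i\<^sub>1, \<dots>, i\<^sub>j] f\<close> is \<open>A i\<^sub>1 (\<dots> (A i\<^sub>j f))\<close>.
\<close>

definition moyal_coeff ::
  "('k::field_char_0 \<Rightarrow> 'a::comm_ring \<Rightarrow> 'a) \<Rightarrow> ('a \<Rightarrow> 'a \<Rightarrow> 'a) \<Rightarrow> nat \<Rightarrow>
   (nat \<Rightarrow> 'a \<Rightarrow> 'a) \<Rightarrow> (nat \<Rightarrow> 'a \<Rightarrow> 'a) \<Rightarrow> nat \<Rightarrow> 'a \<Rightarrow> 'a \<Rightarrow> 'a" where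
  "moyal_coeff scale q n A B k f g =
     (if k = 1 then q f g
      else \<Sum>j=0..k. scale ((-1) ^ (k - j) * (fact k / (fact j * fact (k - j))))
             (\<Sum>is | length is = k \<and> set is \<subseteq> {1..n}.
                foldr A (take j is) (foldr B (drop j is) f) *
                foldr B (take j is) (foldr A (drop j is) g)))"

end

theory Submission imports Defs begin

text \<open>
  By the Jacobi identity and the canonical relations the derivations \<open>A\<^sub>i, B\<^sub>i\<close> commute pairwise.
  The biderivation \<open>\<Sum>\<^sub>i (A\<^sub>i f B\<^sub>i g - B\<^sub>i f A\<^sub>i g)\<close> agrees with \<open>q\<close> when \<open>f\<close> is a generator, hence
  everywhere by density. Therefore \<open>Q\<^sub>k\<close> is the \<open>k\<close>-th power of a constant coefficient
  bidifferential operator, that is,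
  \<open>Q\<^sub>k\<^sub>+\<^sub>1(f, g) = \<Sum>\<^sub>i (Q\<^sub>k(A\<^sub>i f, B\<^sub>i g) - Q\<^sub>k(B\<^sub>i f, A\<^sub>i g))\<close>. By the Leibniz rule and Pascal's
  rule, the coefficients of \<open>t\<^sup>m/m!\<close> in \<open>(f \<star> g) \<star> h\<close> and \<open>f \<star> (g \<star> h)\<close> satisfy
  the same recursion in \<open>m\<close>.
\<close>

section \<open>The \<open>K[[t]]\<close>-bilinear extension of a power series product\<close>

text \<open>The action of \<open>c\<close> and the map here are both Cauchy products, and each
  \<open>D p\<close> commutes with scalars from \<open>K\<close>, so the two convolutions commute. A
  bilinear extension has this shape once one argument is frozen.\<close>

lemma module_hom_fps_convolution:
  assumes vs: "vector_space scale" and D: "\<And>p. module_hom scale scale (D p)"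
  shows "module_hom (fps_scale scale) (fps_scale scale)
           (\<lambda>F. Abs_fps (\<lambda>m. \<Sum>i=0..m. D (m - i) (fps_nth F i)))"
proof -
  interpret vector_space scale by (rule vs)
  interpret S: module "fps_scale scale" by (rule module_fps_scale[OF vs])
  interpret D: module_hom scale scale "D p" for p by (rule D)
  show ?thesis
  proof
    fix F G :: "'b fps" and c :: "'a fps"
    show "Abs_fps (\<lambda>m. \<Sum>i=0..m. D (m - i) (fps_nth (F + G) i)) =
        Abs_fps (\<lambda>m. \<Sum>i=0..m. D (m - i) (fps_nth F i)) +
        Abs_fps (\<lambda>m. \<Sum>i=0..m. D (m - i) (fps_nth G i))"
      by (simp add: fps_eq_iff D.add sum.distrib)
    show "Abs_fps (\<lambda>m. \<Sum>i=0..m. D (m - i) (fps_nth (fps_scale scale c F) i)) =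
        fps_scale scale c (Abs_fps (\<lambda>m. \<Sum>i=0..m. D (m - i) (fps_nth F i)))"
    proof (rule fps_ext)
      fix m
      let ?h = "\<lambda>l i. scale (fps_nth c l) (D (m - (l + i)) (fps_nth F i))"
      \<comment> \<open>The pairs \<open>(l, i)\<close> are regrouped along the diagonals
        \<open>k = l + i\<close>.\<close>
      have "(\<Sum>l=0..m. \<Sum>i=0..m-l. ?h l i) = (\<Sum>k=0..m. \<Sum>l=0..k. ?h l (k - l))"
        using sum.triangle_reindex_eq[of "\<lambda>l i. ?h l i" m]
        by (simp add: sum.Sigma[symmetric] atLeast0AtMost pairs_le_eq_Sigma)
      then show "fps_nth (Abs_fps (\<lambda>m. \<Sum>i=0..m. D (m - i) (fps_nth (fps_scale scale c F) i))) m =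
          fps_nth (fps_scale scale c (Abs_fps (\<lambda>m. \<Sum>i=0..m. D (m - i) (fps_nth F i)))) m"
        by (simp add: fps_scale_nth D.sum D.scale scale_sum_right diff_diff_add)
    qed
  qed
qed

text \<open>Freezing one argument turns the double convolution into a single one with coefficient
  maps \<open>D p\<close>, which gives \<open>K[[t]]\<close>-linearity in the other
  argument.\<close>

lemma bilinear_extension_exists:
  assumes vs: "vector_space scale" and C: "\<And>k. module_bilinear scale (C k)"
  shows "bilinear_extension scale (\<lambda>f g. Abs_fps (\<lambda>k. C k f g))
           (\<lambda>F G. Abs_fps (\<lambda>m. \<Sum>i=0..m. \<Sum>j=0..m-i. C (m - i - j) (fps_nth F i) (fps_nth G j)))"
    (is "bilinear_extension scale _ ?M")
  unfolding bilinear_extension_def module_bilinear_def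
proof (intro conjI allI)
  interpret vector_space scale by (rule vs)
  interpret L: module_hom scale scale "\<lambda>y. C k x y" for k x
    using C by (simp add: module_bilinear_def)
  interpret R: module_hom scale scale "\<lambda>x. C k x y" for k y
    using C by (simp add: module_bilinear_def)
  show "module_hom (fps_scale scale) (fps_scale scale) (\<lambda>F. ?M F G)" for G
    by (rule module_hom_fps_convolution[OF vs, where
          D = "\<lambda>p x. \<Sum>j=0..p. C (p - j) x (fps_nth G j)"])
       (unfold_locales, simp_all add: R.add R.scale sum.distrib scale_sum_right)
  \<comment> \<open>With the sum over \<open>j\<close> outermost, \<open>F\<close> can be frozen in
    the same way as \<open>G\<close> was.\<close>
  have swap: "?M F G = Abs_fps (\<lambda>m. \<Sum>j=0..m. \<Sum>i=0..m-j. C (m - j - i) (fps_nth F i) (fps_nth G j))"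
    for F G
  proof (rule fps_ext)
    fix m
    let ?h = "\<lambda>i j. C (m - i - j) (fps_nth F i) (fps_nth G j)"
    have "(\<Sum>i=0..m. \<Sum>j=0..m-i. ?h i j) = (\<Sum>j=0..m. \<Sum>i=0..m-j. ?h i j)"
      by (simp add: sum.Sigma) (rule sum.reindex_bij_witness[of _ prod.swap prod.swap]; auto)
    then show "fps_nth (?M F G) m = fps_nth
        (Abs_fps (\<lambda>m. \<Sum>j=0..m. \<Sum>i=0..m-j. C (m - j - i) (fps_nth F i) (fps_nth G j))) m"
      by (simp add: add.commute)
  qed
  show "module_hom (fps_scale scale) (fps_scale scale) (\<lambda>G. ?M F G)" for F
    unfolding swap
    by (rule module_hom_fps_convolution[OF vs, where
          D = "\<lambda>p y. \<Sum>i=0..p. C (p - i) (fps_nth F i) y"])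
       (unfold_locales, simp_all add: L.add L.scale sum.distrib scale_sum_right)
  show "?M (fps_const f) (fps_const g) = Abs_fps (\<lambda>k. C k f g)" for f g
  proof (rule fps_ext)
    fix m
    have "(\<Sum>i=0..m. \<Sum>j=0..m-i. C (m - i - j) (fps_nth (fps_const f) i) (fps_nth (fps_const g) j)) =
        (\<Sum>i=0..m. if i = 0 then C m f g else 0)"
    proof (rule sum.cong[OF refl])
      fix i
      have "(\<Sum>j=0..m-i. C (m - i - j) (fps_nth (fps_const f) i) (fps_nth (fps_const g) j)) =
          (\<Sum>j=0..m-i. if j = 0 then C (m - i) (fps_nth (fps_const f) i) g else 0)"
        by (rule sum.cong) (auto simp: L.zero)
      then show "(\<Sum>j=0..m-i. C (m - i - j) (fps_nth (fps_const f) i) (fps_nth (fps_const g) j)) =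
          (if i = 0 then C m f g else 0)"
        by (simp add: R.zero)
    qed
    then show "fps_nth (?M (fps_const f) (fps_const g)) m = fps_nth (Abs_fps (\<lambda>k. C k f g)) m"
      by simp
  qed
qed

text \<open>Both sides are linear in each argument, and a \<open>K[[t]]\<close>-linear map is
  determined by its values on constants. Constants are replaced by arbitrary series one slot at a
  time, in the order \<open>H\<close>, \<open>G\<close>, \<open>F\<close>.\<close>

lemma bilinear_extension_assoc:
  assumes vs: "vector_space scale"
    and M: "module_bilinear (fps_scale scale) M"
    and const: "\<And>f g h. M (M (fps_const f) (fps_const g)) (fps_const h) =
                         M (fps_const f) (M (fps_const g) (fps_const h))"
  shows "M (M F G) H = M F (M G H)"
proof -
  let ?hom = "module_hom (fps_scale scale) (fps_scale scale)"
  have l: "?hom (M F)" and r: "?hom (\<lambda>F. M F G)" for F G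
    using M by (auto simp: module_bilinear_def)
  have comp: "?hom f \<Longrightarrow> ?hom g \<Longrightarrow> ?hom (\<lambda>x. g (f x))" for f g
    using module_hom_compose[of _ _ f _ g] by (simp add: o_def)
  have 1: "M (M (fps_const f) (fps_const g)) H = M (fps_const f) (M (fps_const g) H)" for f g H
    by (rule fps_linear_unique[OF vs l comp[OF l l]]) (rule const)
  have 2: "M (M (fps_const f) G) H = M (fps_const f) (M G H)" for f G H
    by (rule fps_linear_unique[OF vs comp[OF l r] comp[OF r l], of _ H _ H]) (rule 1)
  show ?thesis
    by (rule fps_linear_unique[OF vs comp[OF r r] r, of G H]) (rule 2)
qed

section \<open>Binomial sums and Pascal's rule\<close>

locale unital_comm_algebra_char_0 = unital_comm_algebra scale e
  for scale :: "'k::field_char_0 \<Rightarrow> 'a::comm_ring \<Rightarrow> 'a" and e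
begin

text \<open>The coefficient of \<open>t^m/m!\<close> in a product of two exponential series, where
  \<open>T j k\<close> is the contribution of the coefficients of \<open>t^j/j!\<close> and
  \<open>t^k/k!\<close>.\<close>

definition binomial_sum :: "(nat \<Rightarrow> nat \<Rightarrow> 'a) \<Rightarrow> nat \<Rightarrow> 'a" where
  "binomial_sum T m = (\<Sum>j=0..m. scale (of_nat (m choose j)) (T j (m - j)))"

lemma binomial_sum_0 [simp]: "binomial_sum T 0 = T 0 0"
  by (simp add: binomial_sum_def)

text \<open>Pascal's rule in operator form: \<open>binomial_sum T m\<close> is the value at
  \<open>(0, 0)\<close> of the \<open>m\<close>-th power of the sum of two commuting shifts, one
  raising \<open>j\<close> and one raising \<open>k\<close>.\<close>

lemma binomial_sum_Suc:
  "binomial_sum T (Suc m) = binomial_sum (\<lambda>j k. T (Suc j) k + T j (Suc k)) m"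
proof -
  let ?c = "\<lambda>m j. of_nat (m choose j) :: 'k"
  \<comment> \<open>Since \<open>m choose Suc m = 0\<close>, this sum can be read in two ways:
    without its last term, or with its first term split off.\<close>
  have "(\<Sum>j=0..Suc m. scale (?c m j) (T j (Suc m - j))) =
      (\<Sum>j=0..m. scale (?c m j) (T j (Suc (m - j))))"
    by (simp add: Suc_diff_le)
  moreover have "(\<Sum>j=0..Suc m. scale (?c m j) (T j (Suc m - j))) =
      T 0 (Suc m) + (\<Sum>j=0..m. scale (?c m (Suc j)) (T (Suc j) (m - j)))"
    by (subst sum.atLeast0_atMost_Suc_shift) (simp del: sum.cl_ivl_Suc)
  moreover have "binomial_sum T (Suc m) =
      T 0 (Suc m) + (\<Sum>j=0..m. scale (?c (Suc m) (Suc j)) (T (Suc j) (m - j)))"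
    unfolding binomial_sum_def
    by (subst sum.atLeast0_atMost_Suc_shift) (simp del: sum.cl_ivl_Suc binomial_Suc_Suc)
  ultimately show ?thesis
    by (simp add: binomial_sum_def scale_left_distrib scale_right_distrib sum.distrib algebra_simps)
qed

lemma binomial_sum_add:
  "binomial_sum (\<lambda>j k. S j k + T j k) m = binomial_sum S m + binomial_sum T m"
  by (simp add: binomial_sum_def scale_right_distrib sum.distrib)

lemma binomial_sum_uminus: "binomial_sum (\<lambda>j k. - T j k) m = - binomial_sum T m"
  by (simp add: binomial_sum_def sum_negf)

lemma binomial_sum_sum:
  "binomial_sum (\<lambda>j k. \<Sum>i\<in>I. T i j k) m = (\<Sum>i\<in>I. binomial_sum (T i) m)"
  unfolding binomial_sum_def scale_sum_right by (rule sum.swap)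

end

section \<open>Powers of a constant coefficient bidifferential operator\<close>

text \<open>The index set is left abstract so that the terms \<open>A i \<otimes> B i\<close> and
  \<open>- B i \<otimes> A i\<close> of a bivector can be treated uniformly as
  \<open>X p \<otimes> Y p\<close>.\<close>

locale commuting_derivations = unital_comm_algebra_char_0 scale e
  for scale :: "'k::field_char_0 \<Rightarrow> 'a::comm_ring \<Rightarrow> 'a" and e +
  fixes I :: "'i set" and X Y :: "'i \<Rightarrow> 'a \<Rightarrow> 'a"
  assumes derivation_X: "i \<in> I \<Longrightarrow> derivation scale (X i)"
    and derivation_Y: "i \<in> I \<Longrightarrow> derivation scale (Y i)"
    and XX: "i \<in> I \<Longrightarrow> j \<in> I \<Longrightarrow> X i (X j f) = X j (X i f)"
    and XY: "i \<in> I \<Longrightarrow> j \<in> I \<Longrightarrow> X i (Y j f) = Y j (X i f)"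
    and YY: "i \<in> I \<Longrightarrow> j \<in> I \<Longrightarrow> Y i (Y j f) = Y j (Y i f)"
begin

text \<open>The \<open>k\<close>-th power of the sum of all \<open>X i \<otimes> Y i\<close>,
  followed by multiplication.\<close>

primrec Q :: "nat \<Rightarrow> 'a \<Rightarrow> 'a \<Rightarrow> 'a" where
  "Q 0 f g = f * g"
| "Q (Suc k) f g = (\<Sum>i\<in>I. Q k (X i f) (Y i g))"

lemma derivationD:
  assumes "derivation scale D"
  shows "D (x + y) = D x + D y" "D (scale c x) = scale c (D x)" "D (x * y) = D x * y + x * D y"
    "D (\<Sum>i\<in>J. h i) = (\<Sum>i\<in>J. D (h i))"
proof -
  interpret D: Vector_Spaces.linear scale scale D using assms by (simp add: derivation_def)
  show "D (x + y) = D x + D y" "D (scale c x) = scale c (D x)" "D (\<Sum>i\<in>J. h i) = (\<Sum>i\<in>J. D (h i))"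
    by (rule D.add D.scale D.sum)+
  show "D (x * y) = D x * y + x * D y" using assms by (simp add: derivation_def)
qed

lemma Q_add_left: "Q k (f + f') g = Q k f g + Q k f' g"
  by (induction k arbitrary: f f' g)
     (simp_all add: distrib_right derivationD(1)[OF derivation_X] sum.distrib)

lemma Q_add_right: "Q k f (g + g') = Q k f g + Q k f g'"
  by (induction k arbitrary: f g g')
     (simp_all add: distrib_left derivationD(1)[OF derivation_Y] sum.distrib)

lemma Q_scale_left: "Q k (scale c f) g = scale c (Q k f g)"
  by (induction k arbitrary: f g)
     (simp_all add: scale_mult derivationD(2)[OF derivation_X] scale_sum_right)

lemma Q_scale_right: "Q k f (scale c g) = scale c (Q k f g)"
proof (induction k arbitrary: f g)
  case 0
  show ?case using scale_mult[of c g f] by (simp add: mult.commute)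
qed (simp_all add: derivationD(2)[OF derivation_Y] scale_sum_right)

lemma module_bilinear_Q: "module_bilinear scale (Q k)"
  unfolding module_bilinear_def
  by (intro conjI allI; unfold_locales)
     (simp_all add: Q_add_left Q_add_right Q_scale_left Q_scale_right)

lemma module_bilinear_scale_Q: "module_bilinear scale (\<lambda>f g. scale c (Q k f g))"
  unfolding module_bilinear_def
  by (intro conjI allI; unfold_locales)
     (simp_all add: Q_add_left Q_add_right Q_scale_left Q_scale_right scale_right_distrib mult.commute)

lemma Q_sum_left: "Q k (\<Sum>i\<in>J. f i) g = (\<Sum>i\<in>J. Q k (f i) g)"
proof -
  interpret module_hom scale scale "\<lambda>f. Q k f g"
    using module_bilinear_Q by (simp add: module_bilinear_def)
  show ?thesis by (rule sum)
qed

lemma Q_sum_right: "Q k f (\<Sum>i\<in>J. g i) = (\<Sum>i\<in>J. Q k f (g i))"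
proof -
  interpret module_hom scale scale "\<lambda>g. Q k f g"
    using module_bilinear_Q by (simp add: module_bilinear_def)
  show ?thesis by (rule sum)
qed

text \<open>The operator \<open>D \<otimes> 1 + 1 \<otimes> D\<close> commutes with every
  \<open>X i \<otimes> Y i\<close>, and the Leibniz rule carries \<open>D\<close> through the final
  multiplication.\<close>

lemma derivation_Q:
  assumes D: "derivation scale D"
    and comm: "\<And>i f. i \<in> I \<Longrightarrow> D (X i f) = X i (D f)" "\<And>i f. i \<in> I \<Longrightarrow> D (Y i f) = Y i (D f)"
  shows "D (Q k f g) = Q k (D f) g + Q k f (D g)"
  by (induction k arbitrary: f g) (simp_all add: derivationD[OF D] comm sum.distrib)

lemma X_Q: "i \<in> I \<Longrightarrow> X i (Q k f g) = Q k (X i f) g + Q k f (X i g)"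
  by (rule derivation_Q) (auto simp: derivation_X XX XY)

lemma Y_Q: "i \<in> I \<Longrightarrow> Y i (Q k f g) = Q k (Y i f) g + Q k f (Y i g)"
  by (rule derivation_Q) (auto simp: derivation_Y XY YY)

text \<open>
  Writing \<open>P\<^sub>r\<^sub>s\<close> for the bidifferential operator on the factors \<open>r\<close> and \<open>s\<close> of \<open>f \<otimes> g \<otimes> h\<close>,
  both sides are \<open>(P\<^sub>1\<^sub>2 + P\<^sub>1\<^sub>3 + P\<^sub>2\<^sub>3)\<^sup>m\<close> followed by the multiplication.
\<close>

lemma binomial_sum_Q_assoc:
  "binomial_sum (\<lambda>j k. Q k (Q j f g) h) m = binomial_sum (\<lambda>j k. Q k f (Q j g h)) m"
proof (induction m arbitrary: f g h)
  case 0
  show ?case by (simp add: mult.assoc)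
next
  case (Suc m)
  \<comment> \<open>Raising \<open>j\<close> gives \<open>P\<^sub>1\<^sub>2\<close>. Raising
    \<open>k\<close> applies \<open>X i\<close> to the inner \<open>Q j f g\<close>, where the
    Leibniz rule splits it into \<open>P\<^sub>1\<^sub>3\<close> and
    \<open>P\<^sub>2\<^sub>3\<close>.\<close>
  have "binomial_sum (\<lambda>j k. Q k (Q j f g) h) (Suc m) =
      (\<Sum>i\<in>I. binomial_sum (\<lambda>j k. Q k (Q j (X i f) (Y i g)) h) m) +
      ((\<Sum>i\<in>I. binomial_sum (\<lambda>j k. Q k (Q j (X i f) g) (Y i h)) m) +
       (\<Sum>i\<in>I. binomial_sum (\<lambda>j k. Q k (Q j f (X i g)) (Y i h)) m))"
    by (simp add: binomial_sum_Suc binomial_sum_add binomial_sum_sum[symmetric] Q_sum_left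
        X_Q Q_add_left sum.distrib)
  moreover have "binomial_sum (\<lambda>j k. Q k f (Q j g h)) (Suc m) =
      (\<Sum>i\<in>I. binomial_sum (\<lambda>j k. Q k f (Q j (X i g) (Y i h))) m) +
      ((\<Sum>i\<in>I. binomial_sum (\<lambda>j k. Q k (X i f) (Q j (Y i g) h)) m) +
       (\<Sum>i\<in>I. binomial_sum (\<lambda>j k. Q k (X i f) (Q j g (Y i h))) m))"
    by (simp add: binomial_sum_Suc binomial_sum_add binomial_sum_sum[symmetric] Q_sum_right
        Y_Q Q_add_right sum.distrib)
  \<comment> \<open>The other side lists the same operators in the order
    \<open>P\<^sub>2\<^sub>3\<close>, \<open>P\<^sub>1\<^sub>2\<close>,
    \<open>P\<^sub>1\<^sub>3\<close>; the induction hypothesis applies to each with the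
    differentiated arguments.\<close>
  ultimately show ?case
    by (simp add: Suc.IH algebra_simps)
qed

text \<open>Associativity need only be checked on constants, where the coefficients of
  \<open>t^m\<close> in the two bracketings are \<open>1 / fact m\<close> times the two binomial
  sums already shown equal.\<close>

lemma deformation_quantization_Q:
  assumes "Q 1 = q"
  shows "deformation_quantization scale q Q"
proof -
  let ?C = "\<lambda>k f g. scale (1 / fact k) (Q k f g)"
  let ?M = "\<lambda>F G. Abs_fps (\<lambda>m. \<Sum>i=0..m. \<Sum>j=0..m-i. ?C (m - i - j) (fps_nth F i) (fps_nth G j))"
  have vs: "vector_space scale" by unfold_locales
  have "star scale Q = (\<lambda>f g. Abs_fps (\<lambda>k. ?C k f g))"
    by (intro ext fps_ext) (simp add: star_def)
  then have ext: "bilinear_extension scale (star scale Q) ?M"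
    using bilinear_extension_exists[OF vs, of ?C] module_bilinear_scale_Q by simp
  have const: "?M (fps_const f) (fps_const g) = Abs_fps (\<lambda>k. ?C k f g)" for f g
    using bilinear_extension_exists[OF vs, of ?C] module_bilinear_scale_Q
    by (simp add: bilinear_extension_def)
  \<comment> \<open>This removes all terms that contain a coefficient of positive degree of a
    constant series.\<close>
  have zero: "Q k 0 g = 0" "Q k f 0 = 0" for k f g
    using Q_scale_left[of k 0 0 g] Q_scale_right[of k f 0 0] by simp_all
  have "?M (?M (fps_const f) (fps_const g)) (fps_const h) =
      ?M (fps_const f) (?M (fps_const g) (fps_const h))" for f g h
    unfolding const
  proof (rule fps_ext)
    fix m
    have "(\<Sum>j=0..m-i. ?C (m - i - j) F (fps_nth (fps_const h) j)) = ?C (m - i) F h" for i F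
    proof -
      have "(\<Sum>j=0..m-i. ?C (m - i - j) F (fps_nth (fps_const h) j)) =
          (\<Sum>j=0..m-i. if j = 0 then ?C (m - i) F h else 0)"
        by (rule sum.cong) (auto simp: zero)
      then show ?thesis by simp
    qed
    then have "fps_nth (?M (Abs_fps (\<lambda>k. ?C k f g)) (fps_const h)) m =
        (\<Sum>i=0..m. ?C (m - i) (?C i f g) h)"
      by simp
    \<comment> \<open>Here \<open>1 / (j! (m - j)!)\<close> is rewritten as \<open>1 / m!\<close>
      times a binomial coefficient.\<close>
    also have "\<dots> = scale (1 / fact m) (binomial_sum (\<lambda>j k. Q k (Q j f g) h) m)"
      unfolding binomial_sum_def scale_sum_right
      by (rule sum.cong) (simp_all add: Q_scale_left binomial_fact mult.commute)
    also have "\<dots> = (\<Sum>j=0..m. ?C (m - j) f (?C j g h))"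
      unfolding binomial_sum_Q_assoc unfolding binomial_sum_def scale_sum_right
      by (rule sum.cong) (simp_all add: Q_scale_right binomial_fact mult.commute)
    also have "\<dots> = (\<Sum>i=0..m. if i = 0 then \<Sum>j=0..m. ?C (m - j) f (?C j g h) else 0)"
      by simp
    also have "\<dots> = fps_nth (?M (fps_const f) (Abs_fps (\<lambda>k. ?C k g h))) m"
      unfolding fps_nth_Abs_fps by (rule sum.cong) (auto simp: zero)
    finally show "fps_nth (?M (Abs_fps (\<lambda>k. ?C k f g)) (fps_const h)) m =
        fps_nth (?M (fps_const f) (Abs_fps (\<lambda>k. ?C k g h))) m" .
  qed
  then have "?M (?M F G) H = ?M F (?M G H)" for F G H
    using bilinear_extension_assoc[OF vs, of ?M F G H] ext by (simp add: bilinear_extension_def)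
  then show ?thesis
    unfolding deformation_quantization_def using module_bilinear_Q assms ext by blast
qed

end

section \<open>Sums over multi-indices\<close>

lemma foldr_commute:
  assumes "\<And>j x. j \<in> set js \<Longrightarrow> F (G j x) = G j (F x)"
  shows "foldr G js (F x) = F (foldr G js x)"
  using assms by (induction js) auto

lemma sum_lists_Suc:
  "(\<Sum>js | length js = Suc k \<and> set js \<subseteq> J. h js) =
   (\<Sum>i\<in>J. \<Sum>js | length js = k \<and> set js \<subseteq> J. h (i # js))" (is "?l = _")
proof -
  have "?l = (\<Sum>(i, js)\<in>J \<times> {js. length js = k \<and> set js \<subseteq> J}. h (i # js))"
    by (rule sum.reindex_bij_witness[of _ "\<lambda>(i, js). i # js" "\<lambda>js. (hd js, tl js)"])
       (auto simp: length_Suc_conv)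
  then show ?thesis by (simp add: sum.cartesian_product)
qed

text \<open>Splits off the last letter, which is the one that \<open>foldr\<close> applies
  first.\<close>

lemma sum_lists_Suc_snoc:
  "(\<Sum>js | length js = Suc k \<and> set js \<subseteq> J. h js) =
   (\<Sum>i\<in>J. \<Sum>js | length js = k \<and> set js \<subseteq> J. h (js @ [i]))" (is "?l = _")
proof -
  have "?l = (\<Sum>js | length js = Suc k \<and> set js \<subseteq> J. h (rev js))"
    by (rule sum.reindex_bij_witness[of _ rev rev]) auto
  also have "\<dots> = (\<Sum>i\<in>J. \<Sum>js | length js = k \<and> set js \<subseteq> J. h (rev js @ [i]))"
    by (simp add: sum_lists_Suc)
  also have "\<dots> = (\<Sum>i\<in>J. \<Sum>js | length js = k \<and> set js \<subseteq> J. h (js @ [i]))"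
    by (rule sum.cong[OF refl], rule sum.reindex_bij_witness[of _ rev rev]) auto
  finally show ?thesis .
qed

text \<open>\<open>N k\<close> is the Moyal sum with \<open>l = k - j\<close>. Pascal's rule adds a
  letter either to the front block (\<open>A\<close> on \<open>f\<close>, \<open>B\<close> on
  \<open>g\<close>) or to the back block (roles exchanged), and a letter in the back block flips the
  sign \<open>(-1) ^ l\<close>.\<close>

lemma (in unital_comm_algebra_char_0) binomial_sum_words_Suc:
  fixes A B :: "'i \<Rightarrow> 'a \<Rightarrow> 'a"
  assumes AA: "\<And>i j f. i \<in> J \<Longrightarrow> j \<in> J \<Longrightarrow> A i (A j f) = A j (A i f)"
    and AB: "\<And>i j f. i \<in> J \<Longrightarrow> j \<in> J \<Longrightarrow> A i (B j f) = B j (A i f)"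
    and BB: "\<And>i j f. i \<in> J \<Longrightarrow> j \<in> J \<Longrightarrow> B i (B j f) = B j (B i f)"
  defines "N \<equiv> \<lambda>k f g. binomial_sum (\<lambda>j l. scale ((-1) ^ l)
      (\<Sum>is | length is = j + l \<and> set is \<subseteq> J.
         foldr A (take j is) (foldr B (drop j is) f) *
         foldr B (take j is) (foldr A (drop j is) g))) k"
  shows "N (Suc k) f g = (\<Sum>i\<in>J. N k (A i f) (B i g) - N k (B i f) (A i g))"
proof -
  let ?W = "\<lambda>j l f g. \<Sum>is | length is = j + l \<and> set is \<subseteq> J.
         foldr A (take j is) (foldr B (drop j is) f) *
         foldr B (take j is) (foldr A (drop j is) g)"
  \<comment> \<open>The new letter goes in front, where \<open>foldr\<close> applies it last;
    commutativity moves it inward onto \<open>f\<close> and \<open>g\<close>.\<close>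
  have left: "?W (Suc j) l f g = (\<Sum>i\<in>J. ?W j l (A i f) (B i g))" for j l
    unfolding add_Suc sum_lists_Suc
  proof (intro sum.cong refl)
    fix i js
    assume i: "i \<in> J" and "js \<in> {js. length js = j + l \<and> set js \<subseteq> J}"
    then have js: "set (take j js) \<subseteq> J" "set (drop j js) \<subseteq> J"
      by (auto dest: in_set_takeD in_set_dropD)
    have "foldr A (take j js) (foldr B (drop j js) (A i f)) =
        A i (foldr A (take j js) (foldr B (drop j js) f))"
      using js i by (simp add: foldr_commute[of _ "A i"] AA AB subset_iff)
    moreover have "foldr B (take j js) (foldr A (drop j js) (B i g)) =
        B i (foldr B (take j js) (foldr A (drop j js) g))"
      using js i by (simp add: foldr_commute[of _ "B i"] BB AB subset_iff)
    ultimately show "foldr A (take (Suc j) (i # js)) (foldr B (drop (Suc j) (i # js)) f) *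
        foldr B (take (Suc j) (i # js)) (foldr A (drop (Suc j) (i # js)) g) =
        foldr A (take j js) (foldr B (drop j js) (A i f)) *
        foldr B (take j js) (foldr A (drop j js) (B i g))"
      by simp
  qed
  \<comment> \<open>The new letter goes at the end, so it already acts directly on \<open>f\<close>
    and \<open>g\<close>.\<close>
  have right: "?W j (Suc l) f g = (\<Sum>i\<in>J. ?W j l (B i f) (A i g))" for j l
    unfolding add_Suc_right sum_lists_Suc_snoc by (intro sum.cong refl) simp
  have "N (Suc k) f g = binomial_sum (\<lambda>j l.
      (\<Sum>i\<in>J. scale ((-1) ^ l) (?W j l (A i f) (B i g))) +
      (\<Sum>i\<in>J. - scale ((-1) ^ l) (?W j l (B i f) (A i g)))) k"
    unfolding N_def binomial_sum_Suc left right
    by (simp only: scale_sum_right[of _ _ J] power_Suc mult_minus1 scale_minus_left)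
  then show ?thesis
    unfolding N_def binomial_sum_add binomial_sum_sum binomial_sum_uminus
    by (simp add: sum_subtractf sum_negf)
qed

section \<open>Derivations and density\<close>

text \<open>The Leibniz rule gives closure under products, and at \<open>e * e = e\<close> it gives
  \<open>D e = D e + D e\<close>, hence \<open>D e = 0\<close>.\<close>

lemma subalgebra_kernel:
  assumes "unital_comm_algebra scale e" and D: "derivation scale D"
  shows "subalgebra scale e {x. D x = 0}"
proof -
  interpret unital_comm_algebra scale e by fact
  interpret D: Vector_Spaces.linear scale scale D using D by (simp add: derivation_def)
  have mult: "D (x * y) = D x * y + x * D y" for x y using D by (simp add: derivation_def)
  have "D e = D e + D e"
    using mult[of e e] unit_mult[of e] unit_mult[of "D e"] by (simp add: mult.commute)
  then show ?thesis
    by (auto simp: subalgebra_def subspace_def D.zero D.add D.scale mult)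
qed

text \<open>The difference of the two derivations is a derivation whose kernel is a subalgebra
  containing \<open>S\<close>, hence the hull; by density it vanishes.\<close>

lemma dense_subalgebra_hull_ext:
  assumes "unital_comm_algebra scale e" and D: "derivation scale D" "derivation scale D'"
    and dense: "dense_subalgebra scale e (subalgebra scale e hull S)"
    and eq: "\<And>x. x \<in> S \<Longrightarrow> D x = D' x"
  shows "D x = D' x"
proof -
  interpret unital_comm_algebra scale e by fact
  let ?E = "\<lambda>x. D x - D' x"
  interpret D: Vector_Spaces.linear scale scale D using D by (simp add: derivation_def)
  interpret D': Vector_Spaces.linear scale scale D' using D by (simp add: derivation_def)
  have "Vector_Spaces.linear scale scale ?E"
    by unfold_locales (simp_all add: D.add D'.add D.scale D'.scale scale_right_diff_distrib)
  then have E: "derivation scale ?E"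
    using D by (simp add: derivation_def algebra_simps)
  have "subalgebra scale e hull S \<subseteq> {x. ?E x = 0}"
    by (rule hull_minimal) (use eq subalgebra_kernel[OF assms(1) E] in auto)
  then show ?thesis
    using dense E unfolding dense_subalgebra_def by fastforce
qed

section \<open>Canonical relations and the Moyal product\<close>

theorem theorem5:
  fixes scale :: "'k::field_char_0 \<Rightarrow> 'a::comm_ring \<Rightarrow> 'a"
    and e :: 'a
    and q :: "'a \<Rightarrow> 'a \<Rightarrow> 'a"
    and a b :: "nat \<Rightarrow> 'a"
    and n :: nat
  assumes "unital_comm_algebra scale e"
    and "poisson_bracket scale q"
    and "\<And>i j. i \<in> {1..n} \<Longrightarrow> j \<in> {1..n} \<Longrightarrow> q (a i) (a j) = 0"
    and "\<And>i j. i \<in> {1..n} \<Longrightarrow> j \<in> {1..n} \<Longrightarrow> q (b i) (b j) = 0"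
    and "\<And>i j. i \<in> {1..n} \<Longrightarrow> j \<in> {1..n} \<Longrightarrow> i \<noteq> j \<Longrightarrow> q (a i) (b j) = 0"
    and "\<And>i. i \<in> {1..n} \<Longrightarrow> q (a i) (b i) = e"
    and "dense_subalgebra scale e (subalgebra scale e hull (a ` {1..n} \<union> b ` {1..n}))"
  shows "deformation_quantization scale q
           (moyal_coeff scale q n (\<lambda>k f. q f (b k)) (\<lambda>k f. q (a k) f))"
proof -
  interpret unital_comm_algebra_char_0 scale e
    using assms(1) by (simp add: unital_comm_algebra_char_0_def)
  let ?J = "{1..n}"
  let ?S = "a ` ?J \<union> b ` ?J"
  define A where "A k f = q f (b k)" for k f
  define B where "B k f = q (a k) f" for k f
  have skew: "q f g = - q g f" and der_r: "derivation scale (q f)"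
    and der_l: "derivation scale (\<lambda>f. q f g)"
    and jacobi: "q f (q g h) + q g (q h f) + q h (q f g) = 0" for f g h
    using assms(2) unfolding poisson_bracket_def by blast+
  have lin: "Vector_Spaces.linear scale scale (q f)" for f
    using der_r by (auto simp: derivation_def)
  interpret r: Vector_Spaces.linear scale scale "q f" for f by (rule lin)
  have q_e: "q f e = 0" for f
    using subalgebra_kernel[OF assms(1) der_r] by (auto simp: subalgebra_def)
  \<comment> \<open>By the Jacobi identity the commutator of \<open>q u\<close> and
    \<open>q v\<close> is \<open>q (q u v)\<close>, which vanishes when \<open>q u v\<close> is a
    Casimir element.\<close>
  have comm: "q u (q v f) = q v (q u f)" if "\<And>h. q h (q u v) = 0" for u v f
    using jacobi[of u v f] that[of f] skew[of f u] r.neg[of v "q u f"] by simp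
  \<comment> \<open>In this form \<open>comm\<close> covers the pairs involving \<open>A\<close> as
    well.\<close>
  have A: "A i f = - q (b i) f" for i f
    unfolding A_def by (rule skew)
  \<comment> \<open>The bracket is \<open>0\<close> or \<open>e\<close>, and \<open>q h\<close>
    kills both.\<close>
  have central: "q h (q (a i) (b j)) = 0" if "i \<in> ?J" "j \<in> ?J" for h i j
    using assms(5)[of i j] assms(6)[of i] that q_e r.zero by (cases "i = j") auto
  have AA: "A i (A j f) = A j (A i f)" if "i \<in> ?J" "j \<in> ?J" for i j f
    unfolding A using comm[of "b i" "b j" f] assms(4) that by (simp add: r.neg r.zero)
  have BB: "B i (B j f) = B j (B i f)" if "i \<in> ?J" "j \<in> ?J" for i j f
    unfolding B_def using comm[of "a i" "a j" f] assms(3) that by (simp add: r.zero)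
  have BA: "B i (A j f) = A j (B i f)" if "i \<in> ?J" "j \<in> ?J" for i j f
    unfolding A B_def using comm[of "a i" "b j" f] central that by (simp add: r.neg)
  have der_A: "derivation scale (A i)" and der_B: "derivation scale (B i)" for i
    using der_l[of "b i"] der_r[of "a i"] by (simp_all add: A_def[abs_def] B_def[abs_def])
  interpret A: Vector_Spaces.linear scale scale "A i" for i using der_A by (simp add: derivation_def)
  interpret B: Vector_Spaces.linear scale scale "B i" for i using der_B by (simp add: derivation_def)
  have mult_A: "A i (x * y) = A i x * y + x * A i y"
    and mult_B: "B i (x * y) = B i x * y + x * B i y" for i x y
    using der_A der_B by (auto simp: derivation_def)

  \<comment> \<open>The Poisson bivector in canonical coordinates.\<close>
  let ?q = "\<lambda>f g. \<Sum>i\<in>?J. A i f * B i g - B i f * A i g"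
  have scale_mult_r: "x * scale c y = scale c (x * y)" for c x y
    using scale_mult[of c y x] by (simp add: mult.commute)
  have der_q_r: "derivation scale (?q f)" for f
  proof -
    have "Vector_Spaces.linear scale scale (?q f)"
      by unfold_locales (simp_all add: A.add B.add A.scale B.scale scale_mult_r algebra_simps
          sum.distrib sum_subtractf scale_sum_right scale_right_diff_distrib)
    moreover have "?q f (x * y) = ?q f x * y + x * ?q f y" for x y
      by (simp add: mult_A mult_B sum_distrib_left sum_distrib_right sum.distrib[symmetric] algebra_simps)
    ultimately show ?thesis by (simp add: derivation_def)
  qed
  have der_q_l: "derivation scale (\<lambda>f. ?q f g)" for g
  proof -
    have "Vector_Spaces.linear scale scale (\<lambda>f. ?q f g)"
      by unfold_locales (simp_all add: A.add B.add A.scale B.scale scale_mult[symmetric] scale_mult_r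
          algebra_simps sum.distrib sum_subtractf scale_sum_right scale_right_diff_distrib)
    moreover have "?q (x * y) g = ?q x g * y + x * ?q y g" for x y
      by (simp add: mult_A mult_B sum_distrib_left sum_distrib_right sum.distrib[symmetric] algebra_simps)
    ultimately show ?thesis by (simp add: derivation_def)
  qed
  have gen: "A i (a j) = (if i = j then e else 0)" "A i (b j) = 0"
    "B i (a j) = 0" "B i (b j) = (if i = j then e else 0)" if "i \<in> ?J" "j \<in> ?J" for i j
    using assms(3-6) that by (auto simp: A_def B_def)
  \<comment> \<open>Only the index of the generator survives in the sum. As \<open>g\<close> is
    arbitrary, a single application of density, in the first argument, then gives
    \<open>q = ?q\<close>.\<close>
  have q_gen: "q x g = ?q x g" if "x \<in> ?S" for x g
    using that
  proof
    assume "x \<in> a ` ?J"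
    then obtain j where j: "j \<in> ?J" "x = a j" by blast
    have "?q x g = (\<Sum>i\<in>?J. if i = j then B i g else 0)"
      by (rule sum.cong) (use j gen in \<open>auto simp: unit_mult\<close>)
    then show ?thesis using j by (simp add: B_def)
  next
    assume "x \<in> b ` ?J"
    then obtain j where j: "j \<in> ?J" "x = b j" by blast
    have "?q x g = (\<Sum>i\<in>?J. if i = j then - A i g else 0)"
      by (rule sum.cong) (use j gen in \<open>auto simp: unit_mult\<close>)
    then show ?thesis using j by (simp add: A)
  qed
  have q_eq: "q f g = ?q f g" for f g
    by (rule dense_subalgebra_hull_ext[OF assms(1) der_l der_q_l assms(7)]) (rule q_gen)

  \<comment> \<open>The index \<open>(i, True)\<close> stands for \<open>A i \<otimes> B i\<close>
    and \<open>(i, False)\<close> for \<open>- B i \<otimes> A i\<close>, so the sum over all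
    indices is the bivector \<open>?q\<close>.\<close>
  define X where "X p f = (if snd p then A (fst p) f else - B (fst p) f)" for p :: "nat \<times> bool" and f
  define Y where "Y p f = (if snd p then B (fst p) f else A (fst p) f)" for p :: "nat \<times> bool" and f
  have "derivation scale (\<lambda>f. - B i f)" for i
  proof -
    have "Vector_Spaces.linear scale scale (\<lambda>f. - B i f)"
      by unfold_locales (simp_all add: B.add B.scale)
    then show ?thesis by (simp add: derivation_def mult_B)
  qed
  then have "derivation scale (X p)" "derivation scale (Y p)" for p
    using der_A der_B by (cases "snd p"; simp add: X_def[abs_def] Y_def[abs_def])+
  then interpret cd: commuting_derivations scale e "?J \<times> UNIV" X Y
    by unfold_locales (auto simp: X_def Y_def A.neg B.neg AA BB BA)
  have Q_Suc: "cd.Q (Suc k) f g = (\<Sum>i\<in>?J. cd.Q k (A i f) (B i g) - cd.Q k (B i f) (A i g))" for k f g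
  proof -
    have "cd.Q k (- x) y = - cd.Q k x y" for x y
      using cd.Q_scale_left[of k "-1" x y] by simp
    moreover have "cd.Q (Suc k) f g = (\<Sum>i\<in>?J. \<Sum>s\<in>UNIV. cd.Q k (X (i, s) f) (Y (i, s) g))"
      unfolding cd.Q.simps by (simp add: sum.cartesian_product split_def)
    ultimately show ?thesis by (simp add: UNIV_bool X_def Y_def)
  qed
  have Q1: "cd.Q 1 = q"
    by (intro ext) (simp only: Q_Suc[of 0, folded One_nat_def] cd.Q.simps(1) q_eq)
  have coeff: "moyal_coeff scale q n A B k f g = cd.Q k f g" for k f g
  proof (cases "k = 1")
    case True
    then show ?thesis using Q1 by (simp add: moyal_coeff_def)
  next
    case False
    \<comment> \<open>This is the general formula at every \<open>k\<close>, also at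
      \<open>k = 1\<close> where \<open>moyal_coeff\<close> is \<open>q\<close> by definition, so
      the induction can pass through \<open>1\<close>.\<close>
    let ?N = "\<lambda>k f g. binomial_sum (\<lambda>j l. scale ((-1) ^ l)
      (\<Sum>is | length is = j + l \<and> set is \<subseteq> ?J.
         foldr A (take j is) (foldr B (drop j is) f) *
         foldr B (take j is) (foldr A (drop j is) g))) k"
    have "?N k f g = cd.Q k f g"
    proof (induction k arbitrary: f g)
      case 0
      have "{is :: nat list. is = [] \<and> set is \<subseteq> ?J} = {[]}" by auto
      then show ?case unfolding cd.Q.simps by simp
    next
      case (Suc k)
      have "?N (Suc k) f g = (\<Sum>i\<in>?J. ?N k (A i f) (B i g) - ?N k (B i f) (A i g))"
        by (rule binomial_sum_words_Suc) (rule AA BA[symmetric] BB; assumption)+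
      then show ?case
        by (simp only: Suc.IH Q_Suc)
    qed
    moreover have "moyal_coeff scale q n A B k f g = ?N k f g"
      using False unfolding moyal_coeff_def binomial_sum_def
      by (auto intro!: sum.cong simp: binomial_fact mult.commute)
    ultimately show ?thesis by simp
  qed
  then have "moyal_coeff scale q n A B = cd.Q" by (intro ext)
  then show ?thesis
    using cd.deformation_quantization_Q[OF Q1] by (simp add: A_def[abs_def] B_def[abs_def])
qed

end
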